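(* Let $f\colon\mathbb{R}\to\mathbb{R}$ be convex with $C=\{x\in\mathbb{R}: f(x)\le0\}\neq\varnothing$, and suppose that $f$ is twice differentiable on $\mathbb{R}\setminus C$. Let $G\colon\mathbb{R}\to\mathbb{R}$ be the subgradient projector of $f$. Then $G$ is monotone. Moreover, $G$ is firmly nonexpansive if and only if $$f(x)f''(x)\le\big(f'(x)\big)^2\quad\text{for all }x\in\mathbb{R}\setminus C,$$ and likewise $G$ is nonexpansive if and only if this inequality holds.
   Context: The subgradient projector is $Gx=x-\frac{f(x)}{|s(x)|^2}s(x)$ if $f(x)>0$, where $s$ is a selection of the convex subdifferential $\partial f$, and $Gx=x$ otherwise; here, for $x\notin C$, $s(x)=f'(x)\neq 0$, so $Gx=x-f(x)/f'(x)$. $G$ is monotone if $(x-y)(Gx-Gy)\ge0$ for all $x,y$; nonexpansive if $|Gx-Gy|\le|x-y|$ for all $x,y$; firmly nonexpansive if $|Gx-Gy|^2\le(x-y)(Gx-Gy)$ for all $x,y$. *)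

theory Defs
  imports "HOL-Analysis.Analysis"
begin

definition subdifferential :: "('a::real_inner \<Rightarrow> real) \<Rightarrow> 'a \<Rightarrow> 'a set" where
  "subdifferential f x = {u. \<forall>y. f x + inner u (y - x) \<le> f y}"

definition subgradient_selection :: "('a::real_inner \<Rightarrow> real) \<Rightarrow> ('a \<Rightarrow> 'a) \<Rightarrow> bool" where
  "subgradient_selection f s \<longleftrightarrow> (\<forall>x. s x \<in> subdifferential f x)"

(* If f has a point with value \<le> 0 and s is a subgradient selection, then s x \<noteq> 0
   whenever f x > 0, so the division below is never by zero. *)
definition subgradient_projector ::
    "('a::real_inner \<Rightarrow> real) \<Rightarrow> ('a \<Rightarrow> 'a) \<Rightarrow> 'a \<Rightarrow> 'a" where
  "subgradient_projector f s x =
     (if f x > 0 then x - (f x / (norm (s x))\<^sup>2) *\<^sub>R s x else x)"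

(* Monotonicity of operators on an inner product space, as opposed to the order-theoretic
   constants mono and monotone of HOL. *)
definition monotone_operator :: "('a::real_inner \<Rightarrow> 'a) \<Rightarrow> bool" where
  "monotone_operator T \<longleftrightarrow> (\<forall>x y. inner (x - y) (T x - T y) \<ge> 0)"

definition nonexpansive :: "('a::real_inner \<Rightarrow> 'a) \<Rightarrow> bool" where
  "nonexpansive T \<longleftrightarrow> (\<forall>x y. norm (T x - T y) \<le> norm (x - y))"

definition firmly_nonexpansive :: "('a::real_inner \<Rightarrow> 'a) \<Rightarrow> bool" where
  "firmly_nonexpansive T \<longleftrightarrow>
     (\<forall>x y. (norm (T x - T y))\<^sup>2 \<le> inner (x - y) (T x - T y))"

end

theory Submission
  imports Defs
begin

text \<open>
  Write $h = \mathrm{id} - G$, so that $h = f/s$ off $C$ and $h = 0$ on $C$. Monotonicity of $G$ uses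
  the subgradient inequality only. For a monotone $G$ on the line, nonexpansiveness and firm
  nonexpansiveness both say that $h$ is nondecreasing. Off $C$ we have
  $h' = (f'^2 - f f'')/f'^2$, and since $h$ is nonpositive to the left of $C$, zero on $C$ and
  nonnegative to its right, $h$ is nondecreasing as soon as $h' \ge 0$ off $C$.
\<close>

section \<open>Monotone and nonexpansive maps of the real line\<close>

lemma monotone_operator_real_iff:
  fixes T :: "real \<Rightarrow> real"
  shows "monotone_operator T \<longleftrightarrow> mono T"
proof
  assume T: "monotone_operator T"
  show "mono T"
  proof (rule monoI)
    fix x y :: real
    assume "x \<le> y"
    moreover have "(x - y) * (T x - T y) \<ge> 0"
      using T by (simp add: monotone_operator_def)
    ultimately show "T x \<le> T y"
      by (cases "x = y") (auto simp: zero_le_mult_iff)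
  qed
next
  assume T: "mono T"
  have "(x - y) * (T x - T y) \<ge> 0" for x y
    using monoD[OF T, of x y] monoD[OF T, of y x] linear[of x y] by (auto simp: zero_le_mult_iff)
  then show "monotone_operator T"
    by (simp add: monotone_operator_def)
qed

text \<open>For \<open>x \<le> y\<close> and monotone \<open>T\<close> the bound reads
  \<open>T y - T x \<le> y - x\<close>, which rearranges to the monotonicity of the
  displacement.\<close>

lemma nonexpansive_real_iff:
  fixes T :: "real \<Rightarrow> real"
  assumes T: "mono T"
  shows "nonexpansive T \<longleftrightarrow> mono (\<lambda>x. x - T x)"
proof
  assume N: "nonexpansive T"
  show "mono (\<lambda>x. x - T x)"
  proof (rule monoI)
    fix x y :: real
    assume "x \<le> y"
    moreover have "\<bar>T x - T y\<bar> \<le> \<bar>x - y\<bar>"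
      using N by (simp add: nonexpansive_def)
    ultimately show "x - T x \<le> y - T y"
      by linarith
  qed
next
  assume h: "mono (\<lambda>x. x - T x)"
  have "\<bar>T x - T y\<bar> \<le> \<bar>x - y\<bar>" for x y
    using monoD[OF T, of x y] monoD[OF T, of y x] monoD[OF h, of x y] monoD[OF h, of y x]
    by linarith
  then show "nonexpansive T"
    by (simp add: nonexpansive_def)
qed

text \<open>On the line a nonnegative product is the product of the absolute values, so firm
  nonexpansiveness is nonexpansiveness multiplied by \<open>\<bar>T x - T y\<bar>\<close>.\<close>

lemma firmly_nonexpansive_real_iff:
  fixes T :: "real \<Rightarrow> real"
  assumes T: "mono T"
  shows "firmly_nonexpansive T \<longleftrightarrow> nonexpansive T"
proof -
  have "(T x - T y)\<^sup>2 \<le> (x - y) * (T x - T y) \<longleftrightarrow> \<bar>T x - T y\<bar> \<le> \<bar>x - y\<bar>" for x y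
  proof -
    have prod: "(x - y) * (T x - T y) = \<bar>x - y\<bar> * \<bar>T x - T y\<bar>"
      using monoD[OF T, of x y] monoD[OF T, of y x] by (cases "x \<le> y") (auto simp: abs_if algebra_simps)
    have sq: "(T x - T y)\<^sup>2 = \<bar>T x - T y\<bar> * \<bar>T x - T y\<bar>"
      by (simp add: power2_eq_square)
    \<comment> \<open>The common factor cancels when it is positive; when it vanishes, both
      inequalities hold trivially.\<close>
    show ?thesis
      unfolding prod sq mult_le_cancel_right by auto
  qed
  then show ?thesis
    by (simp add: firmly_nonexpansive_def nonexpansive_def)
qed

section \<open>Subgradients on the line and Newton steps\<close>

lemma subgradient_projector_real:
  fixes f s :: "real \<Rightarrow> real"
  shows "subgradient_projector f s x = (if f x > 0 then x - f x / s x else x)"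
  \<comment> \<open>If \<open>s x = 0\<close>, both formulas give \<open>x\<close>, because division
    by zero yields 0.\<close>
  by (simp add: subgradient_projector_def power2_eq_square)

lemma subgradient_le:
  fixes f s :: "real \<Rightarrow> real"
  assumes "subgradient_selection f s"
  shows "f x + s x * (y - x) \<le> f y"
  using assms by (simp add: subgradient_selection_def subdifferential_def)

lemma subgradient_mono:
  fixes f s :: "real \<Rightarrow> real"
  assumes s: "subgradient_selection f s"
  shows "mono s"
proof (rule monoI)
  fix x y :: real
  assume le: "x \<le> y"
  have "0 \<le> (y - x) * (s y - s x)"
    using subgradient_le[OF s, of x y] subgradient_le[OF s, of y x] by (simp add: algebra_simps)
  with le show "s x \<le> s y"
    by (cases "x = y") (auto simp: zero_le_mult_iff)
qed

text \<open>Subtracting the supporting line from \<open>f\<close> leaves a function that is minimal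
  at \<open>x\<close>, so its derivative there is zero.\<close>

lemma subgradient_eq_deriv:
  fixes f s :: "real \<Rightarrow> real"
  assumes s: "subgradient_selection f s" and f: "f differentiable (at x)"
  shows "s x = deriv f x"
proof -
  have "(f has_real_derivative deriv f x) (at x)"
    using f DERIV_deriv_iff_real_differentiable by blast
  then have "((\<lambda>y. f y - s x * (y - x)) has_real_derivative deriv f x - s x) (at x)"
    by (auto intro!: derivative_eq_intros)
  moreover have "f x - s x * (x - x) \<le> f y - s x * (y - x)" for y
    using subgradient_le[OF s, of x y] by simp
  ultimately have "deriv f x - s x = 0"
    by (intro DERIV_local_min[where d = 1]) auto
  then show ?thesis
    by simp
qed

text \<open>The supporting line at \<open>y\<close> is positive at \<open>y\<close> and, lying below
  \<open>f\<close>, nonpositive at \<open>c\<close>. Hence it slopes upwards and its zero, the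
  Newton point, does not pass \<open>c\<close>.\<close>

lemma subgradient_right:
  fixes f s :: "real \<Rightarrow> real"
  assumes s: "subgradient_selection f s" and "f c \<le> 0" "f y > 0" "c < y"
  shows "s y > 0" "c \<le> y - f y / s y"
proof -
  have le: "f y \<le> s y * (y - c)"
    using subgradient_le[OF s, of y c] assms(2) by (simp add: algebra_simps)
  with assms(3) have "0 < s y * (y - c)"
    by linarith
  with assms(4) show pos: "s y > 0"
    by (simp add: zero_less_mult_iff)
  from le pos show "c \<le> y - f y / s y"
    by (simp add: field_simps)
qed

text \<open>Mirror image of \<open>subgradient_right\<close>: the slope is negative and the Newton
  point stays on the left of \<open>c\<close>.\<close>

lemma subgradient_left:
  fixes f s :: "real \<Rightarrow> real"
  assumes s: "subgradient_selection f s" and "f c \<le> 0" "f y > 0" "y < c"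
  shows "s y < 0" "y - f y / s y \<le> c"
proof -
  have le: "f y \<le> s y * (y - c)"
    using subgradient_le[OF s, of y c] assms(2) by (simp add: algebra_simps)
  with assms(3) have "0 < s y * (y - c)"
    by linarith
  with assms(4) show neg: "s y < 0"
    by (simp add: zero_less_mult_iff)
  from le neg show "y - f y / s y \<le> c"
    by (simp add: field_simps)
qed

section \<open>Monotonicity of the projector\<close>

lemma mono_subgradient_projector:
  fixes f s :: "real \<Rightarrow> real"
  assumes s: "subgradient_selection f s" and c: "f c \<le> 0"
  shows "mono (subgradient_projector f s)"
proof (rule monoI)
  fix x y :: real
  assume "x \<le> y"
  show "subgradient_projector f s x \<le> subgradient_projector f s y"
  proof (cases "x = y")
    case False
    with \<open>x \<le> y\<close> have xy: "x < y"
      by simp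
    consider "f x \<le> 0" "f y \<le> 0" | "f x \<le> 0" "f y > 0" | "f x > 0" "f y \<le> 0"
      | "f x > 0" "f y > 0"
      by linarith
    then show ?thesis
    proof cases
      case 1
      with xy show ?thesis
        by (simp add: subgradient_projector_real)
    next
      case 2
      \<comment> \<open>The fixed point \<open>x\<close> itself serves as the point with nonpositive
        value that the Newton step from \<open>y\<close> cannot pass.\<close>
      with subgradient_right(2)[OF s 2 xy] show ?thesis
        by (simp add: subgradient_projector_real)
    next
      case 3
      with subgradient_left(2)[OF s 3(2,1) xy] show ?thesis
        by (simp add: subgradient_projector_real)
    next
      case 4
      have sxy: "s x \<le> s y"
        using subgradient_mono[OF s] xy by (simp add: monoD)
      have le: "x - f x / s x \<le> y - f y / s y"
      proof -
        \<comment> \<open>The cases are exhaustive since \<open>f c \<le> 0\<close> excludes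
          \<open>c = x\<close> and \<open>c = y\<close>. If \<open>c\<close> lies between, it
          separates the two images; otherwise the supporting line at the point farther from
          \<open>c\<close> is compared with the value at the nearer one.\<close>
        consider "x < c" "c < y" | "c < x" | "y < c"
          using c 4 by (metis linorder_neqE_linordered_idom not_less)
        then show ?thesis
        proof cases
          case 1
          then show ?thesis
            using subgradient_left(2)[OF s c 4(1)] subgradient_right(2)[OF s c 4(2)] by linarith
        next
          case 2
          have sx: "s x > 0" and sy: "s y > 0"
            using subgradient_right(1)[OF s c] 4 2 xy by auto
          have "f y \<le> f x + s y * (y - x)"
            using subgradient_le[OF s, of y x] by (simp add: algebra_simps)
          then have "f y / s y \<le> f x / s y + (y - x)"
            using sy by (simp add: field_simps)
          \<comment> \<open>Slopes increase away from \<open>c\<close>, so the smaller positive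
            slope at \<open>x\<close> gives the longer step.\<close>
          moreover have "f x / s y \<le> f x / s x"
            using sx sxy 4 by (simp add: frac_le)
          ultimately show ?thesis
            by linarith
        next
          case 3
          have sx: "s x < 0" and sy: "s y < 0"
            using subgradient_left(1)[OF s c] 4 3 xy by auto
          have "f x \<le> f y + s x * (x - y)"
            using subgradient_le[OF s, of x y] by (simp add: algebra_simps)
          then have "f x / s x \<ge> (f y + s x * (x - y)) / s x"
            using sx by (intro divide_right_mono_neg) auto
          then have "f x / s x \<ge> f y / s x + (x - y)"
            using sx by (simp add: add_divide_distrib)
          \<comment> \<open>Both slopes are negative with \<open>s x \<le> s y\<close>, so their
            reciprocals are in reverse order.\<close>
          moreover have "f y / s x \<ge> f y / s y"
            using sx sy sxy 4 by (simp add: divide_left_mono mult_neg_neg)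
          ultimately show ?thesis
            by linarith
        qed
      qed
      with 4 show ?thesis
        by (simp add: subgradient_projector_real)
    qed
  qed simp
qed

section \<open>The displacement and its derivative\<close>

lemma subgradient_projector_displacement_deriv:
  fixes f s :: "real \<Rightarrow> real"
  assumes s: "subgradient_selection f s" and c: "f c \<le> 0" and x: "f x > 0"
    and cont: "continuous_on UNIV f"
    and diff: "\<And>x. f x > 0 \<Longrightarrow> f differentiable (at x)"
    and diff2: "deriv f differentiable (at x)"
  shows "((\<lambda>x. x - subgradient_projector f s x) has_real_derivative
      ((deriv f x)\<^sup>2 - f x * deriv (deriv f) x) / (deriv f x)\<^sup>2) (at x)"
    and "deriv f x \<noteq> 0"
proof -
  have sx: "s y = deriv f y" if "f y > 0" for y
    using subgradient_eq_deriv[OF s diff[OF that]] .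
  have "x \<noteq> c"
    using c x by auto
  then have "s x \<noteq> 0"
    using subgradient_left(1)[OF s c x] subgradient_right(1)[OF s c x] by (cases "x < c") auto
  then show nz: "deriv f x \<noteq> 0"
    using sx[OF x] by simp
  have "(f has_real_derivative deriv f x) (at x)"
    using diff[OF x] DERIV_deriv_iff_real_differentiable by blast
  moreover have "(deriv f has_real_derivative deriv (deriv f) x) (at x)"
    using diff2 DERIV_deriv_iff_real_differentiable by blast
  ultimately have "((\<lambda>x. f x / deriv f x) has_real_derivative
      ((deriv f x)\<^sup>2 - f x * deriv (deriv f) x) / (deriv f x)\<^sup>2) (at x)"
    using nz by (auto intro!: derivative_eq_intros simp: power2_eq_square)
  \<comment> \<open>The displacement agrees with \<open>f x / deriv f x\<close> only where
    \<open>f\<close> is positive; openness of that set lets the quotient rule carry over.\<close>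
  moreover have "open {x. 0 < f x}"
    using cont by (intro open_Collect_less) auto
  ultimately show "((\<lambda>x. x - subgradient_projector f s x) has_real_derivative
      ((deriv f x)\<^sup>2 - f x * deriv (deriv f) x) / (deriv f x)\<^sup>2) (at x)"
    using x by (rule_tac has_field_derivative_transform_within_open[where S = "{x. 0 < f x}"])
      (auto simp: subgradient_projector_real sx)
qed

text \<open>The quotient rule turns the differential inequality into a sign condition on the
  derivative where \<open>f\<close> is positive. The converse direction must also compare points
  separated by \<open>C\<close>, where no derivative is at hand; there the sign of the displacement
  decides.\<close>

lemma mono_displacement_iff:
  fixes f s :: "real \<Rightarrow> real"
  assumes s: "subgradient_selection f s" and c: "f c \<le> 0"
    and cont: "continuous_on UNIV f"
    and diff: "\<And>x. f x > 0 \<Longrightarrow> f differentiable (at x)"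
    and diff2: "\<And>x. f x > 0 \<Longrightarrow> deriv f differentiable (at x)"
  shows "mono (\<lambda>x. x - subgradient_projector f s x)
    \<longleftrightarrow> (\<forall>x. f x > 0 \<longrightarrow> f x * deriv (deriv f) x \<le> (deriv f x)\<^sup>2)"
proof -
  define h where "h = (\<lambda>x. x - subgradient_projector f s x)"
  let ?D = "\<lambda>x. ((deriv f x)\<^sup>2 - f x * deriv (deriv f) x) / (deriv f x)\<^sup>2"
  have deriv_h: "(h has_real_derivative ?D x) (at x)" and nz: "deriv f x \<noteq> 0"
    if "f x > 0" for x
    unfolding h_def
    using subgradient_projector_displacement_deriv[OF s c that cont diff diff2[OF that]] by auto
  have D_iff: "0 \<le> ?D x \<longleftrightarrow> f x * deriv (deriv f) x \<le> (deriv f x)\<^sup>2" if "f x > 0" for x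
    using nz[OF that] by (simp add: zero_le_divide_iff)
  have h_eq: "h x = (if f x > 0 then f x / s x else 0)" for x
    by (simp add: h_def subgradient_projector_real)
  have h_right: "0 \<le> h y" if "f a \<le> 0" "a \<le> y" for a y
    using subgradient_right(1)[OF s that(1), of y] that by (cases "a = y") (auto simp: h_eq)
  have h_left: "h y \<le> 0" if "f a \<le> 0" "y \<le> a" for a y
    using subgradient_left(1)[OF s that(1), of y] that
    by (cases "a = y") (auto simp: h_eq divide_le_0_iff)
  have "mono h \<longleftrightarrow> (\<forall>x. f x > 0 \<longrightarrow> 0 \<le> ?D x)"
  proof
    assume h: "mono h"
    show "\<forall>x. f x > 0 \<longrightarrow> 0 \<le> ?D x"
      using mono_on_imp_deriv_nonneg[OF h deriv_h] by simp
  next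
    assume D: "\<forall>x. f x > 0 \<longrightarrow> 0 \<le> ?D x"
    show "mono h"
    proof (rule monoI)
      fix x y :: real
      assume xy: "x \<le> y"
      \<comment> \<open>If the interval meets \<open>C\<close>, then
        \<open>h x \<le> 0 \<le> h y\<close>; if not, \<open>h\<close> is differentiable on all of
        it.\<close>
      consider "\<exists>a. f a \<le> 0 \<and> x \<le> a \<and> a \<le> y" | "\<And>z. x \<le> z \<Longrightarrow> z \<le> y \<Longrightarrow> f z > 0"
        by (meson not_le)
      then show "h x \<le> h y"
      proof cases
        case 1
        then show ?thesis
          using h_left h_right by (meson order_trans)
      next
        case 2
        show ?thesis
          using xy
        proof (rule DERIV_nonneg_imp_nondecreasing)
          fix z
          assume "x \<le> z" "z \<le> y"
          with 2 D deriv_h show "\<exists>d. (h has_real_derivative d) (at z) \<and> 0 \<le> d"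
            by blast
        qed
      qed
    qed
  qed
  then show ?thesis
    unfolding h_def using D_iff by auto
qed

theorem proposition8p2:
  fixes f s G :: "real \<Rightarrow> real" and C :: "real set"
  assumes "convex_on UNIV f"
    and "C = {x. f x \<le> 0}" and "C \<noteq> {}"
    and "\<forall>x. x \<notin> C \<longrightarrow> f differentiable (at x) \<and> deriv f differentiable (at x)"
    and "subgradient_selection f s"
    and "G = subgradient_projector f s"
  shows "monotone_operator G
    \<and> (firmly_nonexpansive G \<longleftrightarrow> (\<forall>x. x \<notin> C \<longrightarrow> f x * deriv (deriv f) x \<le> (deriv f x)\<^sup>2))
    \<and> (nonexpansive G \<longleftrightarrow> (\<forall>x. x \<notin> C \<longrightarrow> f x * deriv (deriv f) x \<le> (deriv f x)\<^sup>2))"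
proof -
  obtain c where c: "f c \<le> 0"
    using assms(2,3) by auto
  have notin: "x \<notin> C \<longleftrightarrow> f x > 0" for x
    using assms(2) by auto
  \<comment> \<open>A finite convex function on the line is continuous, which makes the complement
    of \<open>C\<close> open.\<close>
  have cont: "continuous_on UNIV f"
    using assms(1) by (simp add: convex_on_continuous)
  have mono: "mono G"
    unfolding assms(6) by (rule mono_subgradient_projector[OF assms(5) c])
  have "nonexpansive G \<longleftrightarrow> (\<forall>x. x \<notin> C \<longrightarrow> f x * deriv (deriv f) x \<le> (deriv f x)\<^sup>2)"
    unfolding nonexpansive_real_iff[OF mono] notin unfolding assms(6)
    using assms(4) by (intro mono_displacement_iff[OF assms(5) c cont]) (auto simp: notin)
  then show ?thesis
    using mono by (simp add: monotone_operator_real_iff firmly_nonexpansive_real_iff)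
qed

end
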